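(* For every $n\ge 2$, the following two identities of polynomials in $t$ hold: $$\Omega_{\mathcal{C}_{2n}}(t) = \Omega_{\mathcal{C}_{2n}}(t-1) + n\,\Omega_{Z_{2n-1}}(t-1) + \Omega_{Z_{2n-3}}(t) + \sum_{1\le i<j\le n}\Omega_{Z_{2(n-j+i)-1}}(t-1)\,\Omega_{Z_{2(j-i)-1}}(t)$$ and $$\Omega_{\mathcal{C}_{2n}}(t) = \Omega_{\mathcal{C}_{2n}}(-t) - n\,\Omega_{Z_{2n-1}}(-t) + t\,\Omega_{Z_{2n-3}}(t) - \sum_{\substack{1\le i<j\le n\\ (i,j)\ne(1,n)}}\Omega_{Z_{2(n-j+i)-1}}(-t)\,\Omega_{Z_{2(j-i)-1}}(t).$$
   Context: The crown poset $\mathcal{C}_{2n}$ is the poset on $[2n]$ with cover relations $1\prec 2\succ 3\prec\cdots\succ 2n-1\prec 2n\succ 1$. The zigzag poset $Z_n$ is the poset on $[n]$ with cover relations $1\prec 2\succ 3\prec 4\succ\cdots$ (ending with $n-1\prec n$ if $n$ is even and $n-1\succ n$ if $n$ is odd; $Z_1$ is a single point). For a finite poset $P$, the order polynomial $\Omega_P(t)$ is the unique polynomial such that for every positive integer $m$, $\Omega_P(m)$ is the number of order-preserving maps $f:P\to[m]$ (i.e. $x\preceq y$ implies $f(x)\le f(y)$). *)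

theory Defs
  imports "HOL-Computational_Algebra.Polynomial" "HOL-Library.FuncSet"
begin

text \<open>
  A finite poset is a finite carrier \<open>A\<close> with a relation \<open>r\<close> such that \<open>partial_order_on A r\<close>;
  \<open>(x, y) \<in> r\<close> means that \<open>x\<close> is below or equal to \<open>y\<close>.
\<close>

definition order_preserving_maps :: "'a set \<Rightarrow> 'a rel \<Rightarrow> nat \<Rightarrow> ('a \<Rightarrow> nat) set" where
  "order_preserving_maps A r m = {f \<in> A \<rightarrow>\<^sub>E {1..m}. \<forall>(x, y) \<in> r. f x \<le> f y}"

definition order_polynomial :: "'a set \<Rightarrow> 'a rel \<Rightarrow> rat poly" where
  "order_polynomial A r =
     (THE p. \<forall>m::nat. m > 0 \<longrightarrow> poly p (of_nat m) = of_nat (card (order_preserving_maps A r m)))"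

text \<open>The partial order on \<open>A\<close> generated by a set \<open>c\<close> of pairs \<open>(x, y)\<close> with \<open>x\<close> covered by \<open>y\<close>.\<close>

definition order_of_covers :: "'a set \<Rightarrow> 'a rel \<Rightarrow> 'a rel" where
  "order_of_covers A c = Id_on A \<union> c\<^sup>+"

definition zigzag_covers :: "nat \<Rightarrow> nat rel" where
  "zigzag_covers n =
     {(i, i + 1) |i. 1 \<le> i \<and> i < n \<and> odd i} \<union> {(i + 1, i) |i. 1 \<le> i \<and> i < n \<and> even i}"

definition zigzag_order :: "nat \<Rightarrow> nat rel" where
  "zigzag_order n = order_of_covers {1..n} (zigzag_covers n)"

text \<open>The crown closes the zigzag on \<open>2 * n\<close> points by the additional cover of \<open>1\<close> by \<open>2 * n\<close>.\<close>

definition crown_order :: "nat \<Rightarrow> nat rel" where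
  "crown_order n = order_of_covers {1..2 * n} (insert (1, 2 * n) (zigzag_covers (2 * n)))"

definition zigzag_poly :: "nat \<Rightarrow> rat poly" where
  "zigzag_poly n = order_polynomial {1..n} (zigzag_order n)"

text \<open>The argument is half the number of points: \<open>crown_poly n\<close> belongs to the crown on \<open>2 * n\<close> points.\<close>

definition crown_poly :: "nat \<Rightarrow> rat poly" where
  "crown_poly n = order_polynomial {1..2 * n} (crown_order n)"

lemma partial_order_on_bipartite:
  assumes "c \<subseteq> A \<times> A" and "\<And>x y. (x, y) \<in> c \<Longrightarrow> odd x \<and> even (y::nat)"
  shows "partial_order_on A (order_of_covers A c)"
proof -
  have "trans c"
    using assms(2) by (auto simp: trans_def)
  then have "c\<^sup>+ = c"
    by (rule trancl_id)
  then have eq: "order_of_covers A c = Id_on A \<union> c"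
    by (simp add: order_of_covers_def)
  have "refl_on A (Id_on A \<union> c)"
    by (auto simp: refl_on_def)
  moreover have "trans (Id_on A \<union> c)"
    using \<open>trans c\<close> by (auto simp: trans_def)
  moreover have "antisym (Id_on A \<union> c)"
    using assms(2) by (auto simp: antisym_def)
  ultimately show ?thesis
    using assms(1) unfolding eq by (auto simp: partial_order_on_def preorder_on_def)
qed

lemma partial_order_on_zigzag: "partial_order_on {1..n} (zigzag_order n)"
  unfolding zigzag_order_def
  by (rule partial_order_on_bipartite) (auto simp: zigzag_covers_def)

lemma partial_order_on_crown:
  assumes "n \<ge> 1"
  shows "partial_order_on {1..2 * n} (crown_order n)"
  unfolding crown_order_def
  by (rule partial_order_on_bipartite) (use assms in \<open>auto simp: zigzag_covers_def\<close>)

end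

theory Submission
  imports Defs
begin

text \<open>
  Both posets are bipartite, with the odd points below the even ones. So, except on the one-point
  zigzag, an order-preserving map into \<open>{1..m + 1}\<close> that takes the value \<open>m + 1\<close> takes it at an even
  point. Deleting even points breaks a crown, or a zigzag with an odd number of points, into zigzags
  with an odd number of points.

  For a crown, mark the first and the last even point with the top value. Between them the map is
  arbitrary; outside them, around the cycle, it stays below the top, because every odd point there
  is below an even point without the top value. The only exception is the outside that consists of
  a single point, whose value is unrestricted. Summing over the marked points gives the recurrence
  \<open>crown_count_Suc\<close>, which is the first identity at positive integers: marks that coincide give the
  term with factor \<open>n\<close>, and the exceptional outside gives the separate term
  \<open>\<Omega>(Z\<^bsub>2n-3\<^esub>)(t)\<close>. For a zigzag, marking only the first top point gives \<open>zigzag_count_Suc\<close>. Since a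
  function on the naturals with polynomial differences is a polynomial, the same recurrences show
  by induction that the order polynomials exist.

  The second identity is the first one rewritten by the reciprocities
  \<open>\<Omega>(Z\<^bsub>2k-1\<^esub>)(-t) = -\<Omega>(Z\<^bsub>2k-1\<^esub>)(t-1)\<close> for \<open>k \<ge> 2\<close>, \<open>\<Omega>(Z\<^sub>1)(-t) = -t\<close> and
  \<open>\<Omega>(C\<^bsub>2n\<^esub>)(-t) = \<Omega>(C\<^bsub>2n\<^esub>)(t-1)\<close>, which are read off from the recurrences
  (\<open>zigzag_reciprocity\<close>, \<open>crown_reciprocity\<close>). Reciprocity for shorter zigzags, inserted into the
  recurrence, shows that the difference \<open>\<Omega>(t) - \<Omega>(t-1)\<close> is even in \<open>t\<close> for zigzags and odd in \<open>t\<close> for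
  crowns. Hence, for zigzags on at least three points and for crowns, the sum, respectively the
  difference, of \<open>\<Omega>(-t)\<close> and \<open>\<Omega>(t-1)\<close> is a polynomial with period 1, that is, a constant, and its
  value at \<open>0\<close> is \<open>0\<close>.
\<close>

section \<open>Relabelling and splitting order-preserving maps\<close>

text \<open>
  Being order-preserving only has to be tested on covers, so the lemmas below count maps that
  respect an arbitrary relation, not necessarily an order.
\<close>
lemma order_preserving_maps_order_of_covers:
  "order_preserving_maps A (order_of_covers A c) m = order_preserving_maps A c m"
proof -
  have "f x \<le> f y" if "\<forall>(x, y)\<in>c. f x \<le> f y" "(x, y) \<in> c\<^sup>+" for f :: "'a \<Rightarrow> nat" and x y
    using that(2)
  proof (induction rule: trancl_induct)
    case (base y)
    then show ?case using that(1) by auto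
  next
    case (step y z)
    then show ?case using that(1) by (metis case_prodD le_trans)
  qed
  then show ?thesis
    unfolding order_preserving_maps_def order_of_covers_def by fastforce
qed

lemma finite_order_preserving_maps:
  "finite A \<Longrightarrow> finite (order_preserving_maps A c m)"
  unfolding order_preserving_maps_def
  by (rule finite_subset[of _ "A \<rightarrow>\<^sub>E {1..m}"]) (auto intro: finite_PiE)

lemma card_order_preserving_maps_relabel:
  assumes h: "bij_betw h A B"
    and c: "c \<subseteq> A \<times> A" and d: "d = map_prod h h ` c"
  shows "card (order_preserving_maps A c m) = card (order_preserving_maps B d m)"
proof -
  define g where "g = the_inv_into A h"
  have inj: "inj_on h A" and im: "h ` A = B"
    using h by (auto simp: bij_betw_def)
  have gh: "g (h x) = x" if "x \<in> A" for x
    using that inj by (simp add: g_def the_inv_into_f_f)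
  have hg: "h (g y) = y" "g y \<in> A" if "y \<in> B" for y
    using that h unfolding g_def
    by (auto simp: f_the_inv_into_f_bij_betw the_inv_into_into[OF inj] im)
  have "bij_betw (\<lambda>f. restrict (f \<circ> g) B)
      (order_preserving_maps A c m) (order_preserving_maps B d m)"
  proof (rule bij_betw_byWitness[where f' = "\<lambda>f. restrict (f \<circ> h) A"])
    show "\<forall>f\<in>order_preserving_maps A c m. restrict (restrict (f \<circ> g) B \<circ> h) A = f"
      using im by (auto simp: order_preserving_maps_def PiE_def extensional_def gh restrict_def)
    show "\<forall>f\<in>order_preserving_maps B d m. restrict (restrict (f \<circ> h) A \<circ> g) B = f"
      by (auto simp: order_preserving_maps_def PiE_def extensional_def hg restrict_def)
    show "(\<lambda>f. restrict (f \<circ> g) B) ` order_preserving_maps A c m \<subseteq> order_preserving_maps B d m"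
    proof (rule image_subsetI)
      fix f assume f: "f \<in> order_preserving_maps A c m"
      then have "restrict (f \<circ> g) B \<in> B \<rightarrow>\<^sub>E {1..m}"
        using hg(2) by (simp add: order_preserving_maps_def PiE_iff)
      moreover have "restrict (f \<circ> g) B x \<le> restrict (f \<circ> g) B y" if xy: "(x, y) \<in> d" for x y
      proof -
        obtain a b where ab: "(a, b) \<in> c" "x = h a" "y = h b"
          using xy unfolding d by auto
        then have "a \<in> A" "b \<in> A" using c by auto
        then have "x \<in> B" "y \<in> B" "g x = a" "g y = b"
          using ab im gh by auto
        then show ?thesis
          using f ab(1) by (auto simp: order_preserving_maps_def)
      qed
      ultimately show "restrict (f \<circ> g) B \<in> order_preserving_maps B d m"
        unfolding order_preserving_maps_def by blast
    qed
    show "(\<lambda>f. restrict (f \<circ> h) A) ` order_preserving_maps B d m \<subseteq> order_preserving_maps A c m"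
    proof (rule image_subsetI)
      fix f assume f: "f \<in> order_preserving_maps B d m"
      have "h x \<in> B" if "x \<in> A" for x
        using that im by auto
      then have "restrict (f \<circ> h) A \<in> A \<rightarrow>\<^sub>E {1..m}"
        using f by (simp add: order_preserving_maps_def PiE_iff)
      moreover have "restrict (f \<circ> h) A x \<le> restrict (f \<circ> h) A y" if xy: "(x, y) \<in> c" for x y
      proof -
        have "x \<in> A" "y \<in> A" using c xy by auto
        moreover have "(h x, h y) \<in> d" using xy unfolding d by force
        ultimately show ?thesis
          using f by (auto simp: order_preserving_maps_def)
      qed
      ultimately show "restrict (f \<circ> h) A \<in> order_preserving_maps A c m"
        unfolding order_preserving_maps_def by blast
    qed
  qed
  then show ?thesis by (rule bij_betw_same_card)
qed

text \<open>
  Once the points of \<open>T\<close> carry the top value, relations that end in \<open>T\<close> hold automatically. What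
  remains relates no point of \<open>B\<close> to a point of \<open>C\<close>, so the two restrictions can be chosen
  independently. The separate bound \<open>m'\<close> on \<open>C\<close> makes it possible to exclude the top value there.
\<close>
lemma card_order_preserving_maps_split:
  assumes disj: "B \<inter> C = {}" "T \<inter> (B \<union> C) = {}"
    and c: "c \<subseteq> B \<times> B \<union> C \<times> C \<union> (T \<union> B \<union> C) \<times> T"
    and m: "m' \<le> m" "m > 0"
  shows "card {f \<in> order_preserving_maps (T \<union> B \<union> C) c m.
            (\<forall>x\<in>T. f x = m) \<and> (\<forall>x\<in>C. f x \<le> m')} =
         card (order_preserving_maps B (c \<inter> B \<times> B) m) *
         card (order_preserving_maps C (c \<inter> C \<times> C) m')"
    (is "card ?L = card ?B * card ?C")
proof -
  define glue where "glue = (\<lambda>(g, h) x.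
    if x \<in> B then g x else if x \<in> C then h x else if x \<in> T then m else undefined :: nat)"
  have "bij_betw (\<lambda>f. (restrict f B, restrict f C)) ?L (?B \<times> ?C)"
  proof (rule bij_betw_byWitness[where f' = glue])
    show "\<forall>f\<in>?L. glue (restrict f B, restrict f C) = f"
      by (auto simp: glue_def order_preserving_maps_def PiE_def extensional_def fun_eq_iff)
    show "\<forall>p\<in>?B \<times> ?C. (restrict (glue p) B, restrict (glue p) C) = p"
      using disj by (auto simp: glue_def order_preserving_maps_def PiE_def extensional_def fun_eq_iff)
    show "(\<lambda>f. (restrict f B, restrict f C)) ` ?L \<subseteq> ?B \<times> ?C"
      by (auto simp: order_preserving_maps_def PiE_iff)
    show "glue ` (?B \<times> ?C) \<subseteq> ?L"
    proof clarify
      fix g h assume g: "g \<in> ?B" and h: "h \<in> ?C"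
      have gB: "g x \<in> {1..m}" if "x \<in> B" for x
        using g that by (auto simp: order_preserving_maps_def PiE_iff)
      have hC: "h x \<in> {1..m'}" if "x \<in> C" for x
        using h that by (auto simp: order_preserving_maps_def PiE_iff)
      have range: "glue (g, h) \<in> T \<union> B \<union> C \<rightarrow>\<^sub>E {1..m}"
      proof (rule PiE_I)
        fix x assume "x \<in> T \<union> B \<union> C"
        then show "glue (g, h) x \<in> {1..m}"
          using gB[of x] hC[of x] m by (auto simp: glue_def)
      qed (auto simp: glue_def)
      have top: "glue (g, h) x = m" if "x \<in> T" for x
        using that disj by (auto simp: glue_def)
      have low: "glue (g, h) x \<le> m'" if "x \<in> C" for x
        using that disj hC[OF that] by (auto simp: glue_def)
      have "glue (g, h) x \<le> glue (g, h) y" if xy: "(x, y) \<in> c" for x y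
      proof -
        consider "y \<in> T" "x \<in> T \<union> B \<union> C" | "x \<in> B" "y \<in> B" | "x \<in> C" "y \<in> C"
          using c xy by auto
        then show ?thesis
        proof cases
          case 1
          then show ?thesis using range top[of y] by (auto simp: PiE_iff)
        next
          case 2
          then show ?thesis using g xy by (auto simp: glue_def order_preserving_maps_def)
        next
          case 3
          then show ?thesis using h xy disj by (auto simp: glue_def order_preserving_maps_def)
        qed
      qed
      then show "glue (g, h) \<in> order_preserving_maps (T \<union> B \<union> C) c m \<and>
          (\<forall>x\<in>T. glue (g, h) x = m) \<and> (\<forall>x\<in>C. glue (g, h) x \<le> m')"
        using range top low by (auto simp: order_preserving_maps_def)
    qed
  qed
  then have "card ?L = card (?B \<times> ?C)"
    by (rule bij_betw_same_card)
  then show ?thesis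
    by (simp add: card_cartesian_product)
qed

section \<open>Zigzags and crowns as relations on sets of numbers\<close>

text \<open>
  The zigzag relation restricted to an arbitrary set of positions: the pieces left after a deletion
  are again of this form.
\<close>
definition fence :: "nat set \<Rightarrow> nat rel" where
  "fence A = {(x, y). x \<in> A \<and> y \<in> A \<and> odd x \<and> even y \<and> (y = x + 1 \<or> x = y + 1)}"

text \<open>
  Only zigzags with \<open>2 * k - 1\<close> points occur. The half-open interval also gives the empty
  zigzag for \<open>k = 0\<close>, which has exactly one map and appears between two marks that coincide.
\<close>
definition zigzag_count :: "nat \<Rightarrow> nat \<Rightarrow> nat" where
  "zigzag_count k m = card (order_preserving_maps {1..<2 * k} (fence {1..<2 * k}) m)"

definition crown_edges :: "nat \<Rightarrow> nat rel" where
  "crown_edges n = insert (1, 2 * n) (fence {1..2 * n})"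

definition crown_count :: "nat \<Rightarrow> nat \<Rightarrow> nat" where
  "crown_count n m = card (order_preserving_maps {1..2 * n} (crown_edges n) m)"

text \<open>
  The maps into \<open>{1..m + 1}\<close> of a piece in which no even point takes the value \<open>m + 1\<close>. For
  \<open>k = 1\<close> the piece is a single odd point, on which this imposes nothing.
\<close>
definition open_zigzag_count :: "nat \<Rightarrow> nat \<Rightarrow> nat" where
  "open_zigzag_count k m = zigzag_count k (if k = 1 then Suc m else m)"

lemma zigzag_covers_eq_fence: "zigzag_covers n = fence {1..n}"
  unfolding zigzag_covers_def fence_def by (auto simp: Suc_le_eq elim!: oddE)

lemma card_zigzag:
  "card (order_preserving_maps {1..2 * k - 1} (zigzag_order (2 * k - 1)) m) = zigzag_count k m"
proof -
  have "{1..2 * k - 1} = {1..<2 * k}" by auto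
  then show ?thesis
    by (simp add: zigzag_order_def order_preserving_maps_order_of_covers zigzag_covers_eq_fence
        zigzag_count_def)
qed

lemma card_crown:
  "card (order_preserving_maps {1..2 * n} (crown_order n) m) = crown_count n m"
  by (simp add: crown_order_def order_preserving_maps_order_of_covers zigzag_covers_eq_fence
      crown_count_def crown_edges_def)

lemma zigzag_count_shift:
  "card (order_preserving_maps {2 * a + 1..<2 * a + 2 * k} (fence {2 * a + 1..<2 * a + 2 * k}) m)
   = zigzag_count k m"
  unfolding zigzag_count_def
proof (rule card_order_preserving_maps_relabel[symmetric, where h = "\<lambda>x. x + 2 * a"])
  show "bij_betw (\<lambda>x. x + 2 * a) {1..<2 * k} {2 * a + 1..<2 * a + 2 * k}"
    by (rule bij_betwI[where g = "\<lambda>x. x - 2 * a"]) auto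
  show "fence {1..<2 * k} \<subseteq> {1..<2 * k} \<times> {1..<2 * k}"
    by (auto simp: fence_def)
  show "fence {2 * a + 1..<2 * a + 2 * k} =
      map_prod (\<lambda>x. x + 2 * a) (\<lambda>x. x + 2 * a) ` fence {1..<2 * k}"
  proof (intro set_eqI iffI)
    fix p assume p: "p \<in> fence {2 * a + 1..<2 * a + 2 * k}"
    then have "(fst p - 2 * a, snd p - 2 * a) \<in> fence {1..<2 * k}"
      by (auto simp: fence_def)
    moreover have "p = map_prod (\<lambda>x. x + 2 * a) (\<lambda>x. x + 2 * a) (fst p - 2 * a, snd p - 2 * a)"
      using p by (auto simp: fence_def)
    ultimately show "p \<in> map_prod (\<lambda>x. x + 2 * a) (\<lambda>x. x + 2 * a) ` fence {1..<2 * k}"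
      by (rule rev_image_eqI)
  qed (auto simp: fence_def)
qed

text \<open>
  The part of the crown outside two marked points is a zigzag that runs through the extra cover
  of \<open>1\<close> by \<open>2 * n\<close>: the points after the second mark come first, followed by those before the
  first mark. All shifts are even, so the parity of a point is kept.
\<close>
lemma zigzag_count_cyclic:
  assumes ij: "1 \<le> i" "i \<le> j" "j \<le> n" and n: "n \<ge> 2"
  defines "C \<equiv> {1..<2 * i} \<union> {2 * j + 1..2 * n}"
  shows "card (order_preserving_maps C (crown_edges n \<inter> C \<times> C) m) = zigzag_count (n - j + i) m"
  unfolding zigzag_count_def
proof (rule card_order_preserving_maps_relabel)
  define h where "h = (\<lambda>x. if x < 2 * i then x + 2 * (n - j) else x - 2 * j)"
  define g where "g = (\<lambda>y. if y \<le> 2 * (n - j) then y + 2 * j else y - 2 * (n - j))"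
  define D where "D = {1..<2 * (n - j + i)}"
  have hD: "h x \<in> D" "g (h x) = x" if "x \<in> C" for x
    using that ij by (auto simp: C_def D_def h_def g_def)
  have gC: "g y \<in> C" "h (g y) = y" if "y \<in> D" for y
    using that ij by (auto simp: C_def D_def h_def g_def)
  show "bij_betw h C {1..<2 * (n - j + i)}"
    unfolding D_def[symmetric] by (rule bij_betwI[where g = g]) (auto simp: hD gC)
  show "crown_edges n \<inter> C \<times> C \<subseteq> C \<times> C" by auto
  have pushforward: "(h x, h y) \<in> fence D" if "(x, y) \<in> crown_edges n \<inter> C \<times> C" for x y
    using that ij n
    by (auto simp: fence_def crown_edges_def C_def D_def h_def split: if_splits)
  have pullback: "(g x, g y) \<in> crown_edges n \<inter> C \<times> C" if "(x, y) \<in> fence D" for x y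
  proof -
    have D: "x \<in> D" "y \<in> D" using that by (auto simp: fence_def)
    have *: "odd x" "even y" "y = x + 1 \<or> x = y + 1" using that by (auto simp: fence_def)
    have "(g x, g y) \<in> crown_edges n"
    \<comment> \<open>This is the one edge of the zigzag that comes from the cover of \<open>1\<close> by \<open>2 * n\<close>.\<close>
    proof (cases "x = 2 * (n - j) + 1 \<and> y = 2 * (n - j)")
      case True
      then show ?thesis using D ij by (auto simp: crown_edges_def g_def D_def)
    next
      case False
      have "g x \<in> {1..2 * n}" "g y \<in> {1..2 * n}"
        using gC(1)[OF D(1)] gC(1)[OF D(2)] ij by (auto simp: C_def)
      moreover have "odd (g x)" "even (g y)"
        using * by (auto simp: g_def)
      moreover have "g y = g x + 1 \<or> g x = g y + 1"
      proof -
        have "x \<le> 2 * (n - j) \<longleftrightarrow> y \<le> 2 * (n - j)" if "even N" "N = 2 * (n - j)" for N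
          using * False that(1) unfolding that(2)[symmetric] by presburger
        then show ?thesis
          using *(3) unfolding g_def by auto
      qed
      ultimately show ?thesis by (auto simp: crown_edges_def fence_def)
    qed
    then show ?thesis using gC D by auto
  qed
  show "fence {1..<2 * (n - j + i)} = map_prod h h ` (crown_edges n \<inter> C \<times> C)"
    unfolding D_def[symmetric]
  proof (intro set_eqI iffI)
    fix p assume p: "p \<in> fence D"
    then have "(g (fst p), g (snd p)) \<in> crown_edges n \<inter> C \<times> C"
      using pullback[of "fst p" "snd p"] by simp
    moreover have "p = map_prod h h (g (fst p), g (snd p))"
      using p gC(2)[of "fst p"] gC(2)[of "snd p"] by (auto simp: fence_def)
    ultimately show "p \<in> map_prod h h ` (crown_edges n \<inter> C \<times> C)"
      by (rule rev_image_eqI)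
  next
    fix p assume "p \<in> map_prod h h ` (crown_edges n \<inter> C \<times> C)"
    then show "p \<in> fence D" using pushforward by auto
  qed
qed


section \<open>Recurrences from the positions of the top value\<close>

text \<open>
  Maps into \<open>{1..m + 1}\<close> that are not maps into \<open>{1..m}\<close> are sorted by the first even point
  \<open>2 * i\<close> with the value \<open>m + 1\<close>. No even point before it has the top value, and after it the map is
  arbitrary.
\<close>
lemma zigzag_count_Suc:
  assumes n: "n \<ge> 2"
  shows "zigzag_count n (Suc m) =
    zigzag_count n m + (\<Sum>i=1..n-1. open_zigzag_count i m * zigzag_count (n - i) (Suc m))"
proof -
  define A where "A = {1..<2 * n}"
  define M where "M = order_preserving_maps A (fence A)"
  define lev where "lev = (\<lambda>i :: nat. if i = 1 then Suc m else m :: nat)"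
  define X where "X = (\<lambda>i. {f \<in> M (Suc m).
    (\<forall>x\<in>{2 * i}. f x = Suc m) \<and> (\<forall>x\<in>{1..<2 * i}. f x \<le> lev i)})"
  have fin: "finite (M k)" for k
    unfolding M_def A_def by (rule finite_order_preserving_maps) simp
  have mono: "f x \<le> f y" if "f \<in> M k" "(x, y) \<in> fence A" for f k x y
    using that by (auto simp: M_def order_preserving_maps_def)
  have le: "f x \<le> k" if "f \<in> M k" "x \<in> A" for f k x
    using that by (auto simp: M_def order_preserving_maps_def PiE_iff)
  have low: "f \<in> M m \<longleftrightarrow> f \<in> M (Suc m) \<and> (\<forall>x\<in>A. f x \<le> m)" for f
    by (fastforce simp: M_def order_preserving_maps_def PiE_iff)
  have cover: "\<exists>i\<in>{1..n-1}. f \<in> X i" if f: "f \<in> M (Suc m)" "f \<notin> M m" for f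
  proof -
    obtain x where x: "x \<in> A" "f x = Suc m"
      using f low le by (metis le_SucE)
    define I where "I = {i \<in> {1..n-1}. f (2 * i) = Suc m}"
    have "I \<noteq> {}"
    proof (cases "even x")
      case True
      then have "x div 2 \<in> I" using x by (auto simp: I_def A_def)
      then show ?thesis by auto
    next
      case False
      define y where "y = (if x = 1 then 2 else x - 1)"
      have y: "(x, y) \<in> fence A" "y div 2 \<in> {1..n-1}" "2 * (y div 2) = y" "y \<in> A"
        using x(1) False n by (auto simp: y_def fence_def A_def elim!: oddE)
      have "f y = Suc m"
        using mono[OF f(1) y(1)] le[OF f(1) y(4)] x(2) by simp
      then have "y div 2 \<in> I" using y by (simp add: I_def)
      then show ?thesis by auto
    qed
    moreover have finI: "finite I" by (simp add: I_def)
    ultimately have i: "Min I \<in> I" by simp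
    define i where "i = Min I"
    have least: "k \<ge> i" if "k \<in> I" for k
      using that finI by (simp add: i_def)
    have i1: "1 \<le> i" "i \<le> n - 1" "f (2 * i) = Suc m"
      using i by (auto simp: I_def i_def)
    have "f x \<le> lev i" if x: "x \<in> {1..<2 * i}" for x
    proof (cases "i = 1")
      case True
      then show ?thesis using le[OF f(1), of x] x n by (simp add: lev_def A_def)
    next
      case False
      have *: "f y \<le> m" if y: "even y" "y \<in> {1..<2 * i}" for y
      proof -
        have "y div 2 \<notin> I" using least[of "y div 2"] y by auto
        moreover have "y div 2 \<in> {1..n-1}" "2 * (y div 2) = y" using y i1 by auto
        ultimately have "f y \<noteq> Suc m" by (auto simp: I_def)
        moreover have "f y \<le> Suc m" using le[OF f(1), of y] y i1 by (auto simp: A_def)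
        ultimately show ?thesis by simp
      qed
      show ?thesis
      proof (cases "even x")
        case True
        then show ?thesis using * x \<open>i \<noteq> 1\<close> by (simp add: lev_def)
      next
        case odd: False
        \<comment> \<open>An odd point before the mark has an even neighbour before the mark, since \<open>i \<ge> 2\<close>.\<close>
        define y where "y = (if x = 1 then 2 else x - 1)"
        have "(x, y) \<in> fence A" "even y" "y \<in> {1..<2 * i}"
          using x odd i1 False by (auto simp: y_def fence_def A_def elim!: oddE)
        then show ?thesis
          using mono[OF f(1)] * False by (fastforce simp: lev_def)
      qed
    qed
    then have "f \<in> X i" using f i1 by (auto simp: X_def)
    then show ?thesis using i1 by auto
  qed
  have "M m \<subseteq> M (Suc m)" using low by blast
  moreover have "X i \<subseteq> M (Suc m)" for i by (auto simp: X_def)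
  ultimately have "M (Suc m) = M m \<union> (\<Union>i\<in>{1..n-1}. X i)"
    using cover by blast
  moreover have "M m \<inter> (\<Union>i\<in>{1..n-1}. X i) = {}"
  proof -
    have "f \<notin> M m" if "f \<in> X i" "i \<in> {1..n-1}" for f i
    proof -
      have "2 * i \<in> A" using that(2) by (auto simp: A_def)
      then show ?thesis using low[of f] that(1) by (force simp: X_def)
    qed
    then show ?thesis by blast
  qed
  moreover have "finite (X i)" for i
    using fin by (simp add: X_def)
  moreover have "X i \<inter> X j = {}" if "i \<in> {1..n-1}" "j \<in> {1..n-1}" "i \<noteq> j" for i j
  proof -
    have *: "X i \<inter> X j = {}" if "1 \<le> i" "i < j" for i j
    proof -
      have "2 * i \<in> {1..<2 * j}" "lev j = m" using that by (auto simp: lev_def)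
      then have "f (2 * i) \<le> m" if "f \<in> X j" for f
        using that by (simp add: X_def)
      then show ?thesis by (fastforce simp: X_def)
    qed
    show ?thesis
      using *[of i j] *[of j i] that by (cases "i < j") auto
  qed
  ultimately have "card (M (Suc m)) = card (M m) + (\<Sum>i=1..n-1. card (X i))"
    using fin by (simp add: card_Un_disjoint card_UN_disjoint)
  also have "(\<Sum>i=1..n-1. card (X i)) =
      (\<Sum>i=1..n-1. open_zigzag_count i m * zigzag_count (n - i) (Suc m))"
  proof (rule sum.cong)
    fix i assume i: "i \<in> {1..n-1}"
    define C where "C = {1..<2 * i}"
    define B where "B = {2 * i + 1..<2 * n}"
    have A: "A = {2 * i} \<union> B \<union> C" using i by (auto simp: A_def B_def C_def)
    have "card (X i) = card (order_preserving_maps B (fence A \<inter> B \<times> B) (Suc m)) *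
        card (order_preserving_maps C (fence A \<inter> C \<times> C) (lev i))"
      unfolding X_def M_def C_def[symmetric] unfolding A
    proof (rule card_order_preserving_maps_split)
      show "B \<inter> C = {}" "{2 * i} \<inter> (B \<union> C) = {}" "lev i \<le> Suc m"
        by (auto simp: B_def C_def lev_def)
      show "fence ({2 * i} \<union> B \<union> C) \<subseteq>
          B \<times> B \<union> C \<times> C \<union> ({2 * i} \<union> B \<union> C) \<times> {2 * i}"
      proof (rule subrelI)
        fix x y assume "(x, y) \<in> fence ({2 * i} \<union> B \<union> C)"
        then have xy: "(x, y) \<in> fence A" by (simp add: A)
        then have "odd x" by (auto simp: fence_def)
        then have "x \<noteq> 2 * i" by auto
        then show "(x, y) \<in> B \<times> B \<union> C \<times> C \<union> ({2 * i} \<union> B \<union> C) \<times> {2 * i}"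
          unfolding A[symmetric] using xy by (auto simp: fence_def A_def B_def C_def)
      qed
    qed simp
    also have "fence A \<inter> B \<times> B = fence B"
      unfolding A by (auto simp: fence_def)
    also have "fence A \<inter> C \<times> C = fence C"
      unfolding A by (auto simp: fence_def)
    also have "card (order_preserving_maps B (fence B) (Suc m)) = zigzag_count (n - i) (Suc m)"
    proof -
      have "2 * i + 2 * (n - i) = 2 * n" using i by auto
      then show ?thesis
        using zigzag_count_shift[of i "n - i" "Suc m"] by (simp only: B_def)
    qed
    also have "card (order_preserving_maps C (fence C) (lev i)) = open_zigzag_count i m"
      by (simp add: C_def zigzag_count_def open_zigzag_count_def lev_def)
    finally show "card (X i) = open_zigzag_count i m * zigzag_count (n - i) (Suc m)"
      by simp
  qed simp
  finally show ?thesis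
    by (simp add: M_def A_def zigzag_count_def)
qed

text \<open>
  Here the maps that attain \<open>m + 1\<close> are sorted by the first and the last even point, \<open>2 * i\<close> and
  \<open>2 * j\<close>, with that value; \<open>i = j\<close> means that it is attained at one even point only.
\<close>
lemma crown_count_Suc:
  assumes n: "n \<ge> 2"
  shows "crown_count n (Suc m) = crown_count n m +
    (\<Sum>(i, j)\<in>{(i, j). 1 \<le> i \<and> i \<le> j \<and> j \<le> n}.
       open_zigzag_count (n - j + i) m * zigzag_count (j - i) (Suc m))"
proof -
  define A where "A = {1..2 * n}"
  define E where "E = crown_edges n"
  define M where "M = order_preserving_maps A E"
  define P where "P = {(i, j). 1 \<le> i \<and> i \<le> j \<and> j \<le> n}"
  define lev where "lev = (\<lambda>(i, j). if n - j + i = 1 then Suc m else m :: nat)"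
  define C where "C = (\<lambda>(i, j). {1..<2 * i} \<union> {2 * j + 1..2 * n})"
  define B where "B = (\<lambda>(i, j). {2 * i + 1..<2 * j :: nat})"
  define T where "T = (\<lambda>(i, j). {2 * i, 2 * j :: nat})"
  define X where "X = (\<lambda>p. {f \<in> M (Suc m).
    (\<forall>x\<in>T p. f x = Suc m) \<and> (\<forall>x\<in>C p. f x \<le> lev p)})"
  have "P \<subseteq> {1..n} \<times> {1..n}" by (auto simp: P_def)
  then have finP: "finite P" by (rule finite_subset) simp
  have fin: "finite (M k)" for k
    unfolding M_def A_def by (rule finite_order_preserving_maps) simp
  have mono: "f x \<le> f y" if "f \<in> M k" "(x, y) \<in> E" for f k x y
    using that by (auto simp: M_def order_preserving_maps_def)
  have le: "f x \<le> k" if "f \<in> M k" "x \<in> A" for f k x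
    using that by (auto simp: M_def order_preserving_maps_def PiE_iff)
  have low: "f \<in> M m \<longleftrightarrow> f \<in> M (Suc m) \<and> (\<forall>x\<in>A. f x \<le> m)" for f
    by (fastforce simp: M_def order_preserving_maps_def PiE_iff)
  have cover: "\<exists>p\<in>P. f \<in> X p" if f: "f \<in> M (Suc m)" "f \<notin> M m" for f
  proof -
    obtain x where x: "x \<in> A" "f x = Suc m"
      using f low le by (metis le_SucE)
    define I where "I = {i \<in> {1..n}. f (2 * i) = Suc m}"
    have "I \<noteq> {}"
    proof (cases "even x")
      case True
      then have "x div 2 \<in> I" using x by (auto simp: I_def A_def)
      then show ?thesis by auto
    next
      case False
      have "x + 1 \<le> 2 * n"
        using x(1) False unfolding A_def by (auto; presburger)
      then have y: "(x, x + 1) \<in> E" "(x + 1) div 2 \<in> {1..n}" "2 * ((x + 1) div 2) = x + 1" "x + 1 \<in> A"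
        using x(1) False n by (auto simp: E_def crown_edges_def fence_def A_def elim!: oddE)
      have "f (x + 1) = Suc m"
        using mono[OF f(1) y(1)] le[OF f(1) y(4)] x(2) by simp
      then have "(x + 1) div 2 \<in> I" using y by (simp add: I_def)
      then show ?thesis by auto
    qed
    moreover have finI: "finite I" by (simp add: I_def)
    ultimately have "Min I \<in> I" "Max I \<in> I" by simp_all
    then obtain i j where ij: "i \<in> I" "j \<in> I" "\<And>k. k \<in> I \<Longrightarrow> i \<le> k \<and> k \<le> j"
      using finI by (meson Max_ge Min_le)
    have ij1: "1 \<le> i" "i \<le> j" "j \<le> n" "f (2 * i) = Suc m" "f (2 * j) = Suc m"
      using ij(1,2) ij(3)[OF ij(2)] by (auto simp: I_def)
    have "f x \<le> lev (i, j)" if x: "x \<in> C (i, j)" for x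
    proof (cases "n - j + i = 1")
      case True
      then show ?thesis using le[OF f(1), of x] x ij1 by (auto simp: lev_def A_def C_def)
    next
      case False
      have *: "f y \<le> m" if y: "even y" "y \<in> C (i, j)" for y
      proof -
        have "y div 2 \<notin> I" using ij(3)[of "y div 2"] y by (auto simp: C_def)
        moreover have "y div 2 \<in> {1..n}" "2 * (y div 2) = y" using y ij1 by (auto simp: C_def)
        ultimately have "f y \<noteq> Suc m" by (auto simp: I_def)
        moreover have "f y \<le> Suc m" using le[OF f(1), of y] y ij1 by (auto simp: A_def C_def)
        ultimately show ?thesis by simp
      qed
      show ?thesis
      proof (cases "even x")
        case True
        then show ?thesis using * x False by (simp add: lev_def)
      next
        case odd: False
        \<comment> \<open>The right neighbour lies outside the marks unless \<open>x\<close> immediately precedes the first mark;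
          then the left one does, which for \<open>x = 1\<close> is \<open>2 * n\<close>.\<close>
        define y where "y = (if x + 1 = 2 * i then if i = 1 then 2 * n else x - 1 else x + 1)"
        have "x + 1 \<le> 2 * n" if "2 * j + 1 \<le> x" "x \<le> 2 * n"
          using that odd by presburger
        then have "(x, y) \<in> E \<and> even y \<and> y \<in> C (i, j)"
          using x odd ij1 False
          by (auto simp: y_def E_def crown_edges_def fence_def C_def elim!: oddE)
        then show ?thesis
          using mono[OF f(1), of x y] *[of y] False by (simp add: lev_def)
      qed
    qed
    then have "f \<in> X (i, j)" using f ij1 by (auto simp: X_def T_def)
    then show ?thesis using ij1 by (auto simp: P_def)
  qed
  have "M m \<subseteq> M (Suc m)" using low by blast
  moreover have "X p \<subseteq> M (Suc m)" for p by (auto simp: X_def)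
  ultimately have "M (Suc m) = M m \<union> (\<Union>p\<in>P. X p)"
    using cover by blast
  moreover have "M m \<inter> (\<Union>p\<in>P. X p) = {}"
  proof -
    have "f \<notin> M m" if "f \<in> X (i, j)" "(i, j) \<in> P" for f i j
    proof -
      have "2 * i \<in> A" using that(2) by (auto simp: A_def P_def)
      then show ?thesis using low[of f] that(1) by (force simp: X_def T_def)
    qed
    then show ?thesis by fast
  qed
  moreover have "finite (X p)" for p
    using fin by (simp add: X_def)
  moreover have "X p \<inter> X q = {}" if pq: "p \<in> P" "q \<in> P" "p \<noteq> q" for p q
  proof -
    have *: "X (i, j) \<inter> X (i', j') = {}"
      if "(i, j) \<in> P" "(i', j') \<in> P" "i < i' \<or> j' < j" for i j i' j'
    proof -
      have "lev (i', j') = m" "2 * i \<in> C (i', j') \<or> 2 * j \<in> C (i', j')"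
        using that by (auto simp: P_def lev_def C_def)
      then show ?thesis by (force simp: X_def T_def)
    qed
    obtain i j i' j' where "p = (i, j)" "q = (i', j')" by fastforce
    then show ?thesis
      using *[of i j i' j'] *[of i' j' i j] pq
      by (cases "i < i' \<or> j' < j") (auto simp: Int_commute)
  qed
  ultimately have "card (M (Suc m)) = card (M m) + (\<Sum>p\<in>P. card (X p))"
    using fin finP by (simp add: card_Un_disjoint card_UN_disjoint)
  also have "(\<Sum>p\<in>P. card (X p)) =
      (\<Sum>(i, j)\<in>P. open_zigzag_count (n - j + i) m * zigzag_count (j - i) (Suc m))"
  proof (rule sum.cong)
    fix p assume "p \<in> P"
    then obtain i j where p: "p = (i, j)" and ij: "1 \<le> i" "i \<le> j" "j \<le> n"
      by (auto simp: P_def)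
    have A: "A = T p \<union> B p \<union> C p"
      using ij by (auto simp: p A_def T_def B_def C_def)
    have "card (X p) = card (order_preserving_maps (B p) (E \<inter> B p \<times> B p) (Suc m)) *
        card (order_preserving_maps (C p) (E \<inter> C p \<times> C p) (lev p))"
      unfolding X_def M_def unfolding A
    proof (rule card_order_preserving_maps_split)
      show "B p \<inter> C p = {}" "T p \<inter> (B p \<union> C p) = {}" "lev p \<le> Suc m"
        using ij by (auto simp: p T_def B_def C_def lev_def)
      show "E \<subseteq> B p \<times> B p \<union> C p \<times> C p \<union> (T p \<union> B p \<union> C p) \<times> T p"
      proof (rule subrelI)
        fix x y assume xy: "(x, y) \<in> E"
        then have "odd x" by (auto simp: E_def crown_edges_def fence_def)
        then have "x \<noteq> 2 * i" "x \<noteq> 2 * j" by auto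
        then show "(x, y) \<in> B p \<times> B p \<union> C p \<times> C p \<union> (T p \<union> B p \<union> C p) \<times> T p"
          unfolding A[symmetric] using ij xy
          by (auto simp: p E_def crown_edges_def fence_def A_def T_def B_def C_def)
      qed
    qed simp
    also have "E \<inter> B p \<times> B p = fence (B p)"
      using ij by (auto simp: p E_def crown_edges_def fence_def B_def)
    also have "card (order_preserving_maps (B p) (fence (B p)) (Suc m)) = zigzag_count (j - i) (Suc m)"
      using zigzag_count_shift[of i "j - i" "Suc m"] ij by (simp add: p B_def diff_mult_distrib2)
    also have "card (order_preserving_maps (C p) (E \<inter> C p \<times> C p) (lev p)) =
        open_zigzag_count (n - j + i) m"
      using zigzag_count_cyclic[OF ij n]
      by (simp add: p C_def E_def open_zigzag_count_def lev_def)
    finally show "card (X p) =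
        (case p of (i, j) \<Rightarrow> open_zigzag_count (n - j + i) m * zigzag_count (j - i) (Suc m))"
      by (simp add: p)
  qed simp
  finally show ?thesis
    by (simp add: M_def A_def E_def P_def crown_count_def)
qed


section \<open>Polynomials determined by their differences\<close>

lemma rat_poly_eqI_pos_nat:
  fixes p q :: "rat poly"
  assumes "\<And>m::nat. m > 0 \<Longrightarrow> poly p (of_nat m) = poly q (of_nat m)"
  shows "p = q"
proof (rule ccontr)
  assume "p \<noteq> q"
  then have "finite {x. poly (p - q) x = 0}"
    by (intro poly_roots_finite) simp
  moreover have "(of_nat :: nat \<Rightarrow> rat) ` {0<..} \<subseteq> {x. poly (p - q) x = 0}"
    using assms by auto
  ultimately have "finite ((of_nat :: nat \<Rightarrow> rat) ` {0<..})"
    by (rule rev_finite_subset)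
  then have "finite {0::nat<..}"
    by (rule finite_imageD) (auto simp: inj_on_def)
  then show False
    using infinite_Ioi[of "0::nat"] by simp
qed

lemma order_polynomial_eqI:
  assumes "\<And>m. poly p (of_nat m) = of_nat (card (order_preserving_maps A r m))"
  shows "order_polynomial A r = p"
  unfolding order_polynomial_def
  by (rule the_equality) (auto simp: assms intro: rat_poly_eqI_pos_nat)

text \<open>
  The rising factorials are a basis adapted to the backward difference:
  \<open>pochhammer x (d + 1) - pochhammer (x - 1) (d + 1) = (d + 1) * pochhammer x d\<close>. Subtracting the
  multiple of \<open>pochhammer x d\<close> with the same leading term lowers the degree of \<open>q\<close>.
\<close>
lemma exists_antidifference:
  fixes q :: "'a::field_char_0 poly"
  shows "\<exists>p. \<forall>x. poly p x - poly p (x - 1) = poly q x"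
proof (induction "degree q" arbitrary: q rule: less_induct)
  case less
  define d where "d = degree q"
  define a where "a = lead_coeff q"
  define R where "R = pochhammer [:0, 1 :: 'a:]"
  have poly_R: "poly (R k) x = pochhammer x k" for k x
    by (induction k) (simp_all add: R_def pochhammer_Suc of_nat_poly algebra_simps)
  have deg_R: "degree (R k) = k \<and> lead_coeff (R k) = 1" for k
  proof (induction k)
    case (Suc k)
    have "R (Suc k) = R k * [:of_nat k, 1:]"
      by (simp add: R_def pochhammer_Suc of_nat_poly)
    moreover have "R k \<noteq> 0" using Suc by auto
    ultimately show ?case
      using conjunct1[OF Suc] conjunct2[OF Suc] lead_coeff_mult[of "R k" "[:of_nat k, 1:]"]
      by (simp add: degree_mult_eq del: mult_pCons_right)
  qed (simp add: R_def)
  have lead_R: "coeff (R d) d = 1"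
    using conjunct1[OF deg_R[of d]] conjunct2[OF deg_R[of d]] by simp
  define p\<^sub>1 where "p\<^sub>1 = smult (a / of_nat (Suc d)) (R (Suc d))"
  have p\<^sub>1: "poly p\<^sub>1 x - poly p\<^sub>1 (x - 1) = a * poly (R d) x" for x
  proof -
    have "pochhammer x (Suc d) - pochhammer (x - 1) (Suc d) = of_nat (Suc d) * pochhammer x d"
      unfolding pochhammer_Suc[of x] pochhammer_rec[of "x - 1"] by (simp add: algebra_simps)
    moreover have "poly p\<^sub>1 x - poly p\<^sub>1 (x - 1) =
        a / of_nat (Suc d) * (pochhammer x (Suc d) - pochhammer (x - 1) (Suc d))"
      by (simp only: p\<^sub>1_def poly_smult poly_R right_diff_distrib)
    ultimately show ?thesis
      by (simp add: poly_R del: of_nat_Suc)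
  qed
  define q' where "q' = q - smult a (R d)"
  have "\<exists>p. \<forall>x. poly p x - poly p (x - 1) = poly q' x"
  proof (cases "q' = 0")
    case True
    then show ?thesis by (intro exI[of _ 0]) simp
  next
    case False
    have "coeff q' d = 0"
      using lead_R by (simp add: q'_def d_def a_def)
    then have "degree q' \<noteq> d"
      using False by auto
    moreover have "degree q' \<le> d"
      unfolding q'_def d_def by (rule degree_diff_le) (use deg_R in \<open>auto simp: d_def\<close>)
    ultimately show ?thesis
      using less by (simp add: d_def)
  qed
  then obtain p' where "\<And>x. poly p' x - poly p' (x - 1) = poly q' x" by blast
  then have "poly (p\<^sub>1 + p') x - poly (p\<^sub>1 + p') (x - 1) = poly q x" for x
    using p\<^sub>1[of x] by (simp add: q'_def algebra_simps)
  then show ?case by blast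
qed

lemma polynomial_if_differences_polynomial:
  fixes f :: "nat \<Rightarrow> 'a::field_char_0"
  assumes "\<And>m. f (Suc m) = f m + poly q (of_nat (Suc m))"
  shows "\<exists>p. \<forall>m. poly p (of_nat m) = f m"
proof -
  obtain p where p: "\<And>x. poly p x - poly p (x - 1) = poly q x"
    using exists_antidifference[of q] by blast
  have "poly (p + [:f 0 - poly p 0:]) (of_nat m) = f m" for m
  proof (induction m)
    case (Suc m)
    then show ?case
      using assms[of m] p[of "of_nat (Suc m)"] by (simp add: algebra_simps)
  qed simp
  then show ?thesis by blast
qed

lemma periodic_poly_constant:
  fixes p :: "rat poly"
  assumes "\<And>x. poly p (x + 1) = poly p x"
  shows "poly p x = poly p 0"
proof -
  have "poly p (of_nat m) = poly p 0" for m
  proof (induction m)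
    case (Suc m)
    then show ?case using assms[of "of_nat m"] by (simp add: add.commute)
  qed simp
  then have "p = [:poly p 0:]"
    by (intro rat_poly_eqI_pos_nat) simp
  then show ?thesis
    by (metis mult_zero_right add.right_neutral poly_0 poly_pCons)
qed

section \<open>Order polynomials of zigzags\<close>

lemma zigzag_count_1: "zigzag_count 1 m = m"
proof -
  have "{1..<2 * 1} = {1::nat}" by auto
  then show ?thesis
    by (simp add: zigzag_count_def order_preserving_maps_def fence_def card_PiE)
qed

lemma zigzag_count_0_left: "zigzag_count 0 m = 1"
  by (simp add: zigzag_count_def order_preserving_maps_def fence_def)

lemma zigzag_count_0_right:
  assumes "k \<ge> 1" shows "zigzag_count k 0 = 0"
proof -
  have "{1..<2 * k} \<rightarrow>\<^sub>E {1..0::nat} = {}"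
    using assms by (auto simp: PiE_eq_empty_iff)
  then show ?thesis by (simp add: zigzag_count_def order_preserving_maps_def)
qed

text \<open>
  The argument is the number of available values including the top one, so the value at \<open>m + 1\<close>
  is \<open>open_zigzag_count k m\<close>. With this convention the reciprocity below is uniform in \<open>k\<close>.
\<close>
definition open_zigzag_poly :: "nat \<Rightarrow> rat poly" where
  "open_zigzag_poly k =
     (if k = 1 then [:0, 1:] else zigzag_poly (2 * k - 1) \<circ>\<^sub>p [:-1, 1:])"

text \<open>
  The premise is what the induction in the next lemma supplies for smaller zigzags, before it is
  known for all of them.
\<close>
lemma poly_open_zigzag_if:
  assumes "\<And>m. poly (zigzag_poly (2 * k - 1)) (of_nat m) = of_nat (zigzag_count k m)"
  shows "poly (open_zigzag_poly k) (of_nat (Suc m)) = of_nat (open_zigzag_count k m)"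
  using assms zigzag_count_1
  by (auto simp: open_zigzag_poly_def open_zigzag_count_def poly_pcompose)

text \<open>
  The order polynomial is a definite description, so a polynomial with the right values has to be
  constructed. The recurrence gives one: the differences involve only shorter zigzags.
  The statement includes \<open>m = 0\<close>: that value fixes the constant in the reciprocity.
\<close>
lemma poly_zigzag:
  assumes "k \<ge> 1"
  shows "poly (zigzag_poly (2 * k - 1)) (of_nat m) = of_nat (zigzag_count k m)"
  using assms
proof (induction k arbitrary: m rule: less_induct)
  case (less k)
  have "\<exists>p. \<forall>m. poly p (of_nat m) = (of_nat (zigzag_count k m) :: rat)"
  proof (cases "k = 1")
    case True
    then show ?thesis by (intro exI[of _ "[:0, 1:]"]) (use zigzag_count_1 in simp)
  next
    case False
    define q where "q = (\<Sum>i=1..k-1. open_zigzag_poly i * zigzag_poly (2 * (k - i) - 1))"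
    show ?thesis
    proof (rule polynomial_if_differences_polynomial[where q = q])
      fix m
      have "poly q (of_nat (Suc m)) =
          (\<Sum>i=1..k-1. of_nat (open_zigzag_count i m * zigzag_count (k - i) (Suc m)))"
        unfolding q_def poly_sum poly_mult
      proof (rule sum.cong)
        fix i assume "i \<in> {1..k-1}"
        then have i: "i < k" "i \<ge> 1" "k - i < k" "k - i \<ge> 1" by auto
        show "poly (open_zigzag_poly i) (of_nat (Suc m)) *
            poly (zigzag_poly (2 * (k - i) - 1)) (of_nat (Suc m)) =
            of_nat (open_zigzag_count i m * zigzag_count (k - i) (Suc m))"
          using poly_open_zigzag_if[OF less.IH[OF i(1,2)]] less.IH[OF i(3,4)]
          by (simp only: of_nat_mult)
      qed simp
      then show "of_nat (zigzag_count k (Suc m)) = of_nat (zigzag_count k m) + poly q (of_nat (Suc m))"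
        using zigzag_count_Suc[of k m] less.prems False by simp
    qed
  qed
  then obtain p where p: "\<And>m. poly p (of_nat m) = (of_nat (zigzag_count k m) :: rat)" by blast
  have "zigzag_poly (2 * k - 1) = p"
    unfolding zigzag_poly_def
    by (rule order_polynomial_eqI) (simp only: card_zigzag p)
  then show ?case using p by simp
qed

lemma poly_open_zigzag:
  assumes "k \<ge> 1"
  shows "poly (open_zigzag_poly k) (of_nat (Suc m)) = of_nat (open_zigzag_count k m)"
  using poly_open_zigzag_if poly_zigzag assms by blast

lemma zigzag_poly_1: "zigzag_poly 1 = [:0, 1:]"
  using poly_zigzag[of 1] zigzag_count_1 by (intro rat_poly_eqI_pos_nat) simp

lemma zigzag_poly_difference:
  assumes n: "n \<ge> 2"
  shows "poly (zigzag_poly (2 * n - 1)) x = poly (zigzag_poly (2 * n - 1)) (x - 1) +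
    (\<Sum>i=1..n-1. poly (open_zigzag_poly i) x * poly (zigzag_poly (2 * (n - i) - 1)) x)"
proof -
  have "zigzag_poly (2 * n - 1) = zigzag_poly (2 * n - 1) \<circ>\<^sub>p [:-1, 1:] +
    (\<Sum>i=1..n-1. open_zigzag_poly i * zigzag_poly (2 * (n - i) - 1))" (is "?l = ?r")
  proof (rule rat_poly_eqI_pos_nat)
    fix m :: nat assume "m > 0"
    then obtain k where m: "m = Suc k" using gr0_conv_Suc by blast
    have "(\<Sum>i=1..n-1. poly (open_zigzag_poly i) (of_nat m) * poly (zigzag_poly (2 * (n - i) - 1)) (of_nat m))
        = (\<Sum>i=1..n-1. of_nat (open_zigzag_count i k * zigzag_count (n - i) (Suc k)))"
      unfolding m of_nat_mult
      by (intro sum.cong refl arg_cong2[where f = "(*)"] poly_open_zigzag poly_zigzag) auto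
    moreover have "poly ?l (of_nat m) = of_nat (zigzag_count n m)"
      "poly ?l (of_nat m - 1) = of_nat (zigzag_count n k)"
      using poly_zigzag[of n m] poly_zigzag[of n k] n by (simp_all add: m)
    ultimately show "poly ?l (of_nat m) = poly ?r (of_nat m)"
      using zigzag_count_Suc[OF n, of k] by (simp add: poly_pcompose poly_sum m)
  qed
  then have "poly ?l x = poly ?r x" by (rule arg_cong)
  then show ?thesis by (simp add: poly_pcompose poly_sum)
qed

text \<open>
  Write \<open>\<Omega>\<^sub>k\<close> for the order polynomial of the zigzag on \<open>2 * k - 1\<close> points, and \<open>\<Omega> = \<Omega>\<^sub>n\<close> with
  \<open>n \<ge> 2\<close>. By the induction hypothesis the difference \<open>\<Omega>(t) - \<Omega>(t-1)\<close> is \<open>-\<Sum> \<Omega>\<^sub>i(-t) \<Omega>\<^bsub>n-i\<^esub>(t)\<close>, which is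
  even in \<open>t\<close> by the substitution \<open>i \<mapsto> n - i\<close>. So \<open>\<Omega>(-t) + \<Omega>(t-1)\<close> has period 1 and is constant.
  Its value at \<open>0\<close> vanishes because there are no maps into the empty set.
\<close>
lemma zigzag_reciprocity:
  assumes "n \<ge> 1"
  shows "poly (open_zigzag_poly n) x = - poly (zigzag_poly (2 * n - 1)) (- x)"
  using assms
proof (induction n arbitrary: x rule: less_induct)
  case (less n)
  show ?case
  proof (cases "n = 1")
    case True
    then show ?thesis using zigzag_poly_1 by (simp add: open_zigzag_poly_def)
  next
    case False
    then have n: "n \<ge> 2" using less.prems by simp
    define Z where "Z = (\<lambda>k. poly (zigzag_poly (2 * k - 1)))"
    define r where "r = (\<lambda>x. \<Sum>i=1..n-1. Z i (- x) * Z (n - i) x)"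
    have "(\<Sum>i=1..n-1. poly (open_zigzag_poly i) x * Z (n - i) x) =
        (\<Sum>i=1..n-1. - (Z i (- x) * Z (n - i) x))" for x
      by (rule sum.cong) (use less.IH in \<open>auto simp: Z_def\<close>)
    then have diff: "Z n x = Z n (x - 1) - r x" for x
      using zigzag_poly_difference[OF n, of x] by (simp add: Z_def r_def sum_negf)
    have r_even: "r (- x) = r x" for x
      unfolding r_def
      by (rule sum.reindex_bij_witness[of _ "\<lambda>i. n - i" "\<lambda>i. n - i"]) auto
    define p where "p = zigzag_poly (2 * n - 1) \<circ>\<^sub>p [:0, -1:] + zigzag_poly (2 * n - 1) \<circ>\<^sub>p [:-1, 1:]"
    have p: "poly p x = Z n (- x) + Z n (x - 1)" for x
      by (simp add: p_def Z_def poly_pcompose)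
    have "poly p (x + 1) = poly p x" for x
      using diff[of x] diff[of "- x"] r_even[of x] by (simp add: p)
    then have "poly p x = poly p 0"
      by (rule periodic_poly_constant)
    moreover have Z0: "Z k 0 = 0" if "k \<ge> 1" for k
      using poly_zigzag[OF that, of 0] zigzag_count_0_right[OF that] by (simp add: Z_def)
    then have "r 0 = 0" by (simp add: r_def)
    then have "poly p 0 = 0"
      using diff[of 0] Z0[of n] n by (simp add: p)
    ultimately show ?thesis
      using n p[of x] by (simp add: open_zigzag_poly_def poly_pcompose Z_def)
  qed
qed

section \<open>Order polynomials of crowns\<close>

definition index_pairs :: "nat \<Rightarrow> (nat \<times> nat) set" where
  "index_pairs n = {(i, j). 1 \<le> i \<and> i < j \<and> j \<le> n}"

lemma finite_index_pairs: "finite (index_pairs n)"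
  by (rule finite_subset[of _ "{1..n} \<times> {1..n}"]) (auto simp: index_pairs_def)

text \<open>
  The summands in question depend only on the cyclic distance \<open>a = n - j + i\<close>, and \<open>a\<close> pairs have
  this distance, one for each \<open>i \<le> a\<close>.
\<close>
lemma sum_index_pairs:
  "(\<Sum>(i, j)\<in>index_pairs n. g (n - j + i)) = (\<Sum>a=1..n-1. of_nat a * g a)"
  for g :: "nat \<Rightarrow> 'a::semiring_1"
proof -
  have "(\<Sum>(i, j)\<in>index_pairs n. g (n - j + i)) = (\<Sum>(a, i)\<in>(SIGMA a:{1..n-1}. {1..a}). g a)"
    by (rule sum.reindex_bij_witness[of _ "\<lambda>(a, i). (i, n + i - a)" "\<lambda>(i, j). (n - j + i, i)"])
      (auto simp: index_pairs_def)
  also have "\<dots> = (\<Sum>a=1..n-1. \<Sum>i=1..a. g a)"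
    by (rule sum.Sigma[symmetric]) auto
  finally show ?thesis by simp
qed

text \<open>
  The pairs with \<open>i = j\<close> contribute \<open>n\<close> equal terms, because the zigzag between the marks is empty.
\<close>
lemma crown_count_Suc_index_pairs:
  assumes n: "n \<ge> 2"
  shows "crown_count n (Suc m) = crown_count n m + n * zigzag_count n m +
    (\<Sum>(i, j)\<in>index_pairs n. open_zigzag_count (n - j + i) m * zigzag_count (j - i) (Suc m))"
proof -
  let ?g = "\<lambda>(i, j). open_zigzag_count (n - j + i) m * zigzag_count (j - i) (Suc m)"
  let ?D = "(\<lambda>i. (i, i)) ` {1..n}"
  have "{(i, j). 1 \<le> i \<and> i \<le> j \<and> j \<le> n} = ?D \<union> index_pairs n"
    by (auto simp: index_pairs_def)
  moreover have "?D \<inter> index_pairs n = {}" by (auto simp: index_pairs_def)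
  moreover have "sum ?g ?D = n * zigzag_count n m"
    using n by (simp add: sum.reindex inj_on_def zigzag_count_0_left open_zigzag_count_def)
  ultimately show ?thesis
    using crown_count_Suc[OF n, of m] finite_index_pairs by (simp add: sum.union_disjoint)
qed

definition crown_difference :: "nat \<Rightarrow> rat poly" where
  "crown_difference n = of_nat n * (zigzag_poly (2 * n - 1) \<circ>\<^sub>p [:-1, 1:]) +
     (\<Sum>(i, j)\<in>index_pairs n. open_zigzag_poly (n - j + i) * zigzag_poly (2 * (j - i) - 1))"

lemma crown_poly_difference:
  assumes n: "n \<ge> 2"
  shows "poly (crown_poly n) x = poly (crown_poly n) (x - 1) + poly (crown_difference n) x"
proof -
  have step: "(of_nat (crown_count n (Suc m)) :: rat) =
      of_nat (crown_count n m) + poly (crown_difference n) (of_nat (Suc m))" for m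
  proof -
    have "poly (\<Sum>(i, j)\<in>index_pairs n. open_zigzag_poly (n - j + i) * zigzag_poly (2 * (j - i) - 1))
          (of_nat (Suc m)) =
        of_nat (\<Sum>(i, j)\<in>index_pairs n. open_zigzag_count (n - j + i) m * zigzag_count (j - i) (Suc m))"
      unfolding poly_sum of_nat_sum
    proof (rule sum.cong)
      fix p assume "p \<in> index_pairs n"
      then obtain i j where p: "p = (i, j)" and ij: "n - j + i \<ge> 1" "j - i \<ge> 1"
        by (auto simp: index_pairs_def)
      show "poly (case p of (i, j) \<Rightarrow> open_zigzag_poly (n - j + i) * zigzag_poly (2 * (j - i) - 1))
          (of_nat (Suc m)) =
          of_nat (case p of (i, j) \<Rightarrow> open_zigzag_count (n - j + i) m * zigzag_count (j - i) (Suc m))"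
        using poly_open_zigzag[OF ij(1), of m] poly_zigzag[OF ij(2), of "Suc m"]
        by (simp only: p prod.case poly_mult of_nat_mult)
    qed simp
    then show ?thesis
      using crown_count_Suc_index_pairs[OF n, of m] poly_zigzag[of n m] n
      by (simp add: crown_difference_def poly_pcompose)
  qed
  obtain p where p: "\<And>m. poly p (of_nat m) = (of_nat (crown_count n m) :: rat)"
    using polynomial_if_differences_polynomial[OF step] by blast
  have crown: "crown_poly n = p"
    unfolding crown_poly_def by (rule order_polynomial_eqI) (simp only: card_crown p)
  have "p = p \<circ>\<^sub>p [:-1, 1:] + crown_difference n"
  proof (rule rat_poly_eqI_pos_nat)
    fix m :: nat assume "m > 0"
    then obtain k where m: "m = Suc k" using gr0_conv_Suc by blast
    show "poly p (of_nat m) = poly (p \<circ>\<^sub>p [:-1, 1:] + crown_difference n) (of_nat m)"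
      using step[of k] p[of k] p[of m] by (simp add: m poly_pcompose)
  qed
  then have "poly p x = poly (p \<circ>\<^sub>p [:-1, 1:] + crown_difference n) x" by (rule arg_cong)
  then show ?thesis by (simp add: crown poly_pcompose)
qed

text \<open>
  By \<open>zigzag_reciprocity\<close> the sum over pairs becomes \<open>-s(t)\<close> with
  \<open>s(t) = \<Sum> a \<Omega>\<^sub>a(-t) \<Omega>\<^bsub>n-a\<^esub>(t)\<close>, in the notation used there. The
  reflection \<open>a \<mapsto> n - a\<close> turns the weight \<open>a\<close> in \<open>s(-t)\<close> into \<open>n - a\<close>, so \<open>s(t) + s(-t)\<close> has the constant weight \<open>n\<close> and is a multiple of the zigzag
  difference. This is cancelled by the terms with factor \<open>n\<close>.
\<close>
lemma crown_difference_odd: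
  assumes n: "n \<ge> 2"
  shows "poly (crown_difference n) (- x) = - poly (crown_difference n) x"
proof -
  define Z where "Z = (\<lambda>k. poly (zigzag_poly (2 * k - 1)))"
  define s where "s = (\<lambda>x. \<Sum>a=1..n-1. of_nat a * (Z a (- x) * Z (n - a) x))"
  have rec: "poly (open_zigzag_poly k) x = - Z k (- x)" if "k \<ge> 1" for k x
    using zigzag_reciprocity[OF that] by (simp add: Z_def)
  have diff: "poly (crown_difference n) x = of_nat n * Z n (x - 1) - s x" for x
  proof -
    have "(\<Sum>(i, j)\<in>index_pairs n. poly (open_zigzag_poly (n - j + i)) x * Z (j - i) x) =
        (\<Sum>(i, j)\<in>index_pairs n. - (Z (n - j + i) (- x) * Z (n - (n - j + i)) x))"
      by (rule sum.cong) (auto simp: index_pairs_def rec)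
    also have "\<dots> = - s x"
      using sum_index_pairs[of "\<lambda>a. - (Z a (- x) * Z (n - a) x)" n]
      by (simp add: s_def sum_negf)
    finally show ?thesis
      by (simp add: crown_difference_def poly_sum poly_pcompose Z_def case_prod_beta)
  qed
  have "s (- x) = (\<Sum>a=1..n-1. of_nat (n - a) * (Z a (- x) * Z (n - a) x))"
    unfolding s_def
    by (rule sum.reindex_bij_witness[of _ "\<lambda>a. n - a" "\<lambda>a. n - a"]) auto
  then have "s x + s (- x) = (\<Sum>a=1..n-1. (of_nat a + of_nat (n - a)) * (Z a (- x) * Z (n - a) x))"
    by (simp only: s_def distrib_right sum.distrib)
  also have "\<dots> = (\<Sum>a=1..n-1. of_nat n * (Z a (- x) * Z (n - a) x))"
    by (rule sum.cong) (auto simp flip: of_nat_add)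
  also have "\<dots> = of_nat n * (Z n (x - 1) - Z n x)"
    using zigzag_poly_difference[OF n, of x]
    by (simp add: rec sum_negf sum_distrib_left Z_def right_diff_distrib)
  finally have "s x + s (- x) = of_nat n * (Z n (x - 1) - Z n x)" .
  moreover have "Z n (- 1 - x) = - Z n x"
    using rec[of n "- x"] n by (simp add: open_zigzag_poly_def poly_pcompose Z_def)
  then have "Z n (- x - 1) = - Z n x"
    by (simp only: diff_conv_add_uminus add.commute[of "- x"])
  ultimately show ?thesis
    by (simp add: diff algebra_simps)
qed

text \<open>
  The periodic polynomial \<open>p(t) = \<Omega>(-t) - \<Omega>(t-1)\<close> satisfies \<open>p(1) = -p(0)\<close> by its very form, so the
  constant is \<open>0\<close>.
\<close>
lemma crown_reciprocity:
  assumes n: "n \<ge> 2"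
  shows "poly (crown_poly n) (- x) = poly (crown_poly n) (x - 1)"
proof -
  define p where "p = crown_poly n \<circ>\<^sub>p [:0, -1:] - crown_poly n \<circ>\<^sub>p [:-1, 1:]"
  have p: "poly p x = poly (crown_poly n) (- x) - poly (crown_poly n) (x - 1)" for x
    by (simp add: p_def poly_pcompose)
  have per: "poly p (x + 1) = poly p x" for x
    using crown_poly_difference[OF n, of x] crown_poly_difference[OF n, of "- x"]
      crown_difference_odd[OF n, of x]
    by (simp add: p)
  have "poly p 1 = - poly p 0" by (simp add: p)
  then have "poly p 0 = 0" using per[of 0] by simp
  then have "poly p x = 0" using periodic_poly_constant[OF per] by simp
  then show ?thesis by (simp add: p)
qed

section \<open>The two identities\<close>

text \<open>
  The pair \<open>(1, n)\<close> is the only one whose outside is a single point. Splitting it off leaves a sum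
  \<open>U\<close> in which every outside zigzag has at least three points, so that it can be read both as a
  shift by \<open>-1\<close> and, up to sign, as a reflection of the argument.
\<close>
theorem theorem4p2:
  fixes n :: nat
  assumes "n \<ge> 2"
  shows
    "crown_poly n =
       crown_poly n \<circ>\<^sub>p [:-1, 1:]
       + of_nat n * (zigzag_poly (2 * n - 1) \<circ>\<^sub>p [:-1, 1:])
       + zigzag_poly (2 * n - 3)
       + (\<Sum>(i, j) \<in> {(i, j). 1 \<le> i \<and> i < j \<and> j \<le> n}.
            (zigzag_poly (2 * (n - j + i) - 1) \<circ>\<^sub>p [:-1, 1:]) * zigzag_poly (2 * (j - i) - 1))
     \<and>
     crown_poly n =
       crown_poly n \<circ>\<^sub>p [:0, -1:]
       - of_nat n * (zigzag_poly (2 * n - 1) \<circ>\<^sub>p [:0, -1:])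
       + [:0, 1:] * zigzag_poly (2 * n - 3)
       - (\<Sum>(i, j) \<in> {(i, j). 1 \<le> i \<and> i < j \<and> j \<le> n \<and> (i, j) \<noteq> (1, n)}.
            (zigzag_poly (2 * (n - j + i) - 1) \<circ>\<^sub>p [:0, -1:]) * zigzag_poly (2 * (j - i) - 1))"
proof -
  define P where "P = {(i, j). 1 \<le> i \<and> i < j \<and> j \<le> n \<and> (i, j) \<noteq> (1, n)}"
  have pairs: "index_pairs n = insert (1, n) P" "(1, n) \<notin> P"
    using assms by (auto simp: P_def index_pairs_def)
  have finP: "finite P"
    using finite_index_pairs[of n] by (simp add: pairs)
  have last: "2 * (n - Suc 0) - Suc 0 = 2 * n - 3" by simp
  have P_gt: "n - j + i \<ge> 2" if "(i, j) \<in> P" for i j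
    using that by (auto simp: P_def)
  define U where "U = (\<Sum>(i, j)\<in>P. open_zigzag_poly (n - j + i) * zigzag_poly (2 * (j - i) - 1))"
  have diff: "crown_difference n = of_nat n * (zigzag_poly (2 * n - 1) \<circ>\<^sub>p [:-1, 1:]) +
      [:0, 1:] * zigzag_poly (2 * n - 3) + U"
    using assms finP pairs(2)
    by (simp add: crown_difference_def pairs(1) U_def last open_zigzag_poly_def)
  have shift: "crown_poly n = crown_poly n \<circ>\<^sub>p [:-1, 1:] + crown_difference n"
    by (rule poly_eq_poly_eq_iff[THEN iffD1], rule ext)
      (simp add: poly_pcompose crown_poly_difference[OF assms, symmetric])
  have U_shift: "U = (\<Sum>(i, j)\<in>P.
      (zigzag_poly (2 * (n - j + i) - 1) \<circ>\<^sub>p [:-1, 1:]) * zigzag_poly (2 * (j - i) - 1))"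
    unfolding U_def
    by (rule sum.cong) (use P_gt in \<open>fastforce simp: open_zigzag_poly_def\<close>)+
  have flip: "open_zigzag_poly k = - (zigzag_poly (2 * k - 1) \<circ>\<^sub>p [:0, -1:])" if "k \<ge> 1" for k
    by (rule poly_eq_poly_eq_iff[THEN iffD1], rule ext)
      (simp add: poly_pcompose zigzag_reciprocity[OF that])
  have U_flip: "U = - (\<Sum>(i, j)\<in>P.
      (zigzag_poly (2 * (n - j + i) - 1) \<circ>\<^sub>p [:0, -1:]) * zigzag_poly (2 * (j - i) - 1))"
    unfolding U_def sum_negf[symmetric]
  proof (rule sum.cong)
    fix p assume "p \<in> P"
    then obtain i j where p: "p = (i, j)" and "n - j + i \<ge> 1"
      by (auto simp: P_def)
    then show "(case p of (i, j) \<Rightarrow> open_zigzag_poly (n - j + i) * zigzag_poly (2 * (j - i) - 1)) =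
      - (case p of (i, j) \<Rightarrow> (zigzag_poly (2 * (n - j + i) - 1) \<circ>\<^sub>p [:0, -1:]) * zigzag_poly (2 * (j - i) - 1))"
      by (simp only: p prod.case flip mult_minus_left)
  qed simp
  have crown_flip: "crown_poly n \<circ>\<^sub>p [:-1, 1:] = crown_poly n \<circ>\<^sub>p [:0, -1:]"
    by (rule poly_eq_poly_eq_iff[THEN iffD1], rule ext)
      (simp add: poly_pcompose crown_reciprocity[OF assms])
  have top: "zigzag_poly (2 * n - 1) \<circ>\<^sub>p [:-1, 1:] = - (zigzag_poly (2 * n - 1) \<circ>\<^sub>p [:0, -1:])"
    using flip[of n] assms by (simp add: open_zigzag_poly_def)
  \<comment> \<open>\<open>t\<close> is \<open>1\<close> plus the shifted polynomial of the one-point zigzag, which restores the pair \<open>(1, n)\<close>.\<close>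
  have "[:0, 1:] * zigzag_poly (2 * n - 3) + U = zigzag_poly (2 * n - 3) +
      (\<Sum>(i, j)\<in>index_pairs n.
        (zigzag_poly (2 * (n - j + i) - 1) \<circ>\<^sub>p [:-1, 1:]) * zigzag_poly (2 * (j - i) - 1))"
    using finP pairs(2) zigzag_poly_1 assms
    by (simp add: pairs(1) last U_shift pcompose_pCons add.assoc)
  then have "crown_poly n =
       crown_poly n \<circ>\<^sub>p [:-1, 1:]
       + of_nat n * (zigzag_poly (2 * n - 1) \<circ>\<^sub>p [:-1, 1:])
       + zigzag_poly (2 * n - 3)
       + (\<Sum>(i, j) \<in> index_pairs n.
            (zigzag_poly (2 * (n - j + i) - 1) \<circ>\<^sub>p [:-1, 1:]) * zigzag_poly (2 * (j - i) - 1))"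
    by (intro trans[OF shift]) (simp add: diff add.assoc)
  moreover have "crown_poly n =
       crown_poly n \<circ>\<^sub>p [:0, -1:]
       - of_nat n * (zigzag_poly (2 * n - 1) \<circ>\<^sub>p [:0, -1:])
       + [:0, 1:] * zigzag_poly (2 * n - 3)
       - (\<Sum>(i, j) \<in> P.
            (zigzag_poly (2 * (n - j + i) - 1) \<circ>\<^sub>p [:0, -1:]) * zigzag_poly (2 * (j - i) - 1))"
    by (rule trans[OF shift]) (simp add: diff crown_flip top[simplified] U_flip)
  ultimately show ?thesis
    unfolding index_pairs_def P_def by blast
qed

end
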